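(* Let $A$ be an anticommutative g-alternative algebra over a field $F$ with $\mathrm{Ann}(A)=0$. Then $\mathfrak{B}(A)$ is an associative algebra; in particular, $\mathfrak{B}(A)$ is an alternative algebra.
   Context: Algebras: an algebra over a field $F$ is an $F$-vector space with an $F$-bilinear multiplication, not assumed associative or unital. $A$ is alternative if $x^2y=x(xy)$ and $yx^2=(yx)x$ for all $x,y\in A$. $A$ is g-alternative if for all $x,y,z\in A$: $x(yz)=(xy)z+(yx)z-y(xz)$ and $(xy)z=x(yz)+x(zy)-(xz)y$. $A$ is anticommutative if $aa'=-a'a$ for all $a,a'\in A$. $\mathrm{Ann}(A)=\{z\in A\mid az=za=0\text{ for all }a\in A\}$. Derived actions: a derived action in $\mathrm{gAlt}$ (the category of g-alternative algebras over $F$) of a g-alternative algebra $B$ on a g-alternative algebra $A$ is a pair of $F$-bilinear maps $B\times A\to A$, $(b,a)\mapsto ba$, and $A\times B\to A$, $(a,b)\mapsto ab$, such that for all $a,a_1,a_2\in A$, $b,b_1,b_2\in B$: $b(a_1a_2)=(ba_1)a_2+(a_1b)a_2-a_1(ba_2)$; $(a_1a_2)b=a_1(a_2b)+a_1(ba_2)-(a_1b)a_2$; $(ba_1)a_2=b(a_1a_2)+b(a_2a_1)-(ba_2)a_1$; $a_1(a_2b)=(a_1a_2)b+(a_2a_1)b-a_2(a_1b)$; $(b_1b_2)a=b_1(b_2a)+b_1(ab_2)-(b_1a)b_2$; $a(b_1b_2)=(ab_1)b_2+(b_1a)b_2-b_1(ab_2)$; $(ab_1)b_2=a(b_1b_2)+a(b_2b_1)-(ab_2)b_1$;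 $b_1(b_2a)=(b_1b_2)a+(b_2b_1)a-b_2(b_1a)$. Let $\{B_i\}_{i\in I}$ be the family of all g-alternative algebras equipped with a derived action on $A$ in $\mathrm{gAlt}$. $\mathfrak{B}(A)$: for a pair $f$ of $F$-linear maps $A\to A$ write $fa$ for the value of the first map at $a$ and $af$ for the value of the second. Each $b\in B_i$ gives the pair $(a\mapsto ba,\ a\mapsto ab)$; let $\mathbb{B}$ be the set of all pairs so obtained. On pairs define addition componentwise and a product $ff'$ by $(ff')a=f(f'a)+f(af')-(fa)f'$, $a(ff')=(af)f'+(fa)f'-f(af')$. Then $\mathfrak{B}(A)$ (the universal strict general actor of $A$) is the $F$-algebra of all pairs obtained from elements of $\mathbb{B}$ by repeatedly applying addition, negation and this product (pairs giving the same maps are identified). *)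

theory Defs
  imports "HOL-Algebra.Module"
begin

section \<open>Non-associative algebras over a field\<close>

definition bilinear_map ::
  "('f, 'm) ring_scheme \<Rightarrow> ('f, 'u, 'k) module_scheme \<Rightarrow> ('f, 'v, 'l) module_scheme
    \<Rightarrow> ('f, 'w, 'n) module_scheme \<Rightarrow> ('u \<Rightarrow> 'v \<Rightarrow> 'w) \<Rightarrow> bool" where
  "bilinear_map F U V W \<beta> \<longleftrightarrow>
    (\<forall>u \<in> carrier U. \<forall>v \<in> carrier V. \<beta> u v \<in> carrier W) \<and>
    (\<forall>u \<in> carrier U. \<forall>u' \<in> carrier U. \<forall>v \<in> carrier V.
       \<beta> (u \<oplus>\<^bsub>U\<^esub> u') v = \<beta> u v \<oplus>\<^bsub>W\<^esub> \<beta> u' v) \<and>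
    (\<forall>u \<in> carrier U. \<forall>v \<in> carrier V. \<forall>v' \<in> carrier V.
       \<beta> u (v \<oplus>\<^bsub>V\<^esub> v') = \<beta> u v \<oplus>\<^bsub>W\<^esub> \<beta> u v') \<and>
    (\<forall>c \<in> carrier F. \<forall>u \<in> carrier U. \<forall>v \<in> carrier V.
       \<beta> (c \<odot>\<^bsub>U\<^esub> u) v = c \<odot>\<^bsub>W\<^esub> \<beta> u v) \<and>
    (\<forall>c \<in> carrier F. \<forall>u \<in> carrier U. \<forall>v \<in> carrier V.
       \<beta> u (c \<odot>\<^bsub>V\<^esub> v) = c \<odot>\<^bsub>W\<^esub> \<beta> u v)"

text \<open>
  The records of type \<open>module\<close> carry a multiplication and a unit. The multiplication is
  used as the product of the algebra; nothing is assumed about the unit field, which is ignored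
  throughout.
\<close>

locale nonassoc_algebra = field F + module F A for F (structure) and A (structure) +
  assumes mult_bilinear: "bilinear_map F A A A (mult A)"

definition associative :: "('a, 'n) ring_scheme \<Rightarrow> bool" where
  "associative A \<longleftrightarrow>
    (\<forall>x \<in> carrier A. \<forall>y \<in> carrier A. \<forall>z \<in> carrier A.
       (x \<otimes>\<^bsub>A\<^esub> y) \<otimes>\<^bsub>A\<^esub> z = x \<otimes>\<^bsub>A\<^esub> (y \<otimes>\<^bsub>A\<^esub> z))"

definition alternative :: "('a, 'n) ring_scheme \<Rightarrow> bool" where
  "alternative A \<longleftrightarrow>
    (\<forall>x \<in> carrier A. \<forall>y \<in> carrier A.
       (x \<otimes>\<^bsub>A\<^esub> x) \<otimes>\<^bsub>A\<^esub> y = x \<otimes>\<^bsub>A\<^esub> (x \<otimes>\<^bsub>A\<^esub> y) \<and>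
       y \<otimes>\<^bsub>A\<^esub> (x \<otimes>\<^bsub>A\<^esub> x) = (y \<otimes>\<^bsub>A\<^esub> x) \<otimes>\<^bsub>A\<^esub> x)"

definition g_alternative :: "('a, 'n) ring_scheme \<Rightarrow> bool" where
  "g_alternative A \<longleftrightarrow>
    (\<forall>x \<in> carrier A. \<forall>y \<in> carrier A. \<forall>z \<in> carrier A.
       x \<otimes>\<^bsub>A\<^esub> (y \<otimes>\<^bsub>A\<^esub> z) =
         ((x \<otimes>\<^bsub>A\<^esub> y) \<otimes>\<^bsub>A\<^esub> z \<oplus>\<^bsub>A\<^esub> (y \<otimes>\<^bsub>A\<^esub> x) \<otimes>\<^bsub>A\<^esub> z) \<ominus>\<^bsub>A\<^esub> y \<otimes>\<^bsub>A\<^esub> (x \<otimes>\<^bsub>A\<^esub> z) \<and>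
       (x \<otimes>\<^bsub>A\<^esub> y) \<otimes>\<^bsub>A\<^esub> z =
         (x \<otimes>\<^bsub>A\<^esub> (y \<otimes>\<^bsub>A\<^esub> z) \<oplus>\<^bsub>A\<^esub> x \<otimes>\<^bsub>A\<^esub> (z \<otimes>\<^bsub>A\<^esub> y)) \<ominus>\<^bsub>A\<^esub> (x \<otimes>\<^bsub>A\<^esub> z) \<otimes>\<^bsub>A\<^esub> y)"

definition anticommutative :: "('a, 'n) ring_scheme \<Rightarrow> bool" where
  "anticommutative A \<longleftrightarrow>
    (\<forall>x \<in> carrier A. \<forall>y \<in> carrier A. x \<otimes>\<^bsub>A\<^esub> y = \<ominus>\<^bsub>A\<^esub> (y \<otimes>\<^bsub>A\<^esub> x))"

definition Ann :: "('a, 'n) ring_scheme \<Rightarrow> 'a set" where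
  "Ann A = {z \<in> carrier A. \<forall>a \<in> carrier A. a \<otimes>\<^bsub>A\<^esub> z = \<zero>\<^bsub>A\<^esub> \<and> z \<otimes>\<^bsub>A\<^esub> a = \<zero>\<^bsub>A\<^esub>}"

section \<open>Derived actions of g-alternative algebras\<close>

text \<open>
  In \<open>derived_action F B A l r\<close>, the value \<open>l b a\<close> is the element \<open>ba\<close> and \<open>r a b\<close> is the
  element \<open>ab\<close> of \<open>A\<close>. The locale only states the conditions on the two maps; that
  \<open>A\<close> and \<open>B\<close> are g-alternative algebras over \<open>F\<close> is required where it is used.
\<close>

locale derived_action =
  fixes F :: "('f, 'm) ring_scheme"
    and B :: "('f, 'b, 'k) module_scheme"
    and A :: "('f, 'a, 'n) module_scheme"
    and l :: "'b \<Rightarrow> 'a \<Rightarrow> 'a"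
    and r :: "'a \<Rightarrow> 'b \<Rightarrow> 'a"
  assumes l_bilinear: "bilinear_map F B A A l"
    and r_bilinear: "bilinear_map F A B A r"
    and act1: "\<lbrakk> b \<in> carrier B; a1 \<in> carrier A; a2 \<in> carrier A \<rbrakk> \<Longrightarrow>
      l b (a1 \<otimes>\<^bsub>A\<^esub> a2) = (l b a1 \<otimes>\<^bsub>A\<^esub> a2 \<oplus>\<^bsub>A\<^esub> r a1 b \<otimes>\<^bsub>A\<^esub> a2) \<ominus>\<^bsub>A\<^esub> a1 \<otimes>\<^bsub>A\<^esub> l b a2"
    and act2: "\<lbrakk> b \<in> carrier B; a1 \<in> carrier A; a2 \<in> carrier A \<rbrakk> \<Longrightarrow>
      r (a1 \<otimes>\<^bsub>A\<^esub> a2) b = (a1 \<otimes>\<^bsub>A\<^esub> r a2 b \<oplus>\<^bsub>A\<^esub> a1 \<otimes>\<^bsub>A\<^esub> l b a2) \<ominus>\<^bsub>A\<^esub> r a1 b \<otimes>\<^bsub>A\<^esub> a2"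
    and act3: "\<lbrakk> b \<in> carrier B; a1 \<in> carrier A; a2 \<in> carrier A \<rbrakk> \<Longrightarrow>
      l b a1 \<otimes>\<^bsub>A\<^esub> a2 = (l b (a1 \<otimes>\<^bsub>A\<^esub> a2) \<oplus>\<^bsub>A\<^esub> l b (a2 \<otimes>\<^bsub>A\<^esub> a1)) \<ominus>\<^bsub>A\<^esub> l b a2 \<otimes>\<^bsub>A\<^esub> a1"
    and act4: "\<lbrakk> b \<in> carrier B; a1 \<in> carrier A; a2 \<in> carrier A \<rbrakk> \<Longrightarrow>
      a1 \<otimes>\<^bsub>A\<^esub> r a2 b = (r (a1 \<otimes>\<^bsub>A\<^esub> a2) b \<oplus>\<^bsub>A\<^esub> r (a2 \<otimes>\<^bsub>A\<^esub> a1) b) \<ominus>\<^bsub>A\<^esub> a2 \<otimes>\<^bsub>A\<^esub> r a1 b"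
    and act5: "\<lbrakk> b1 \<in> carrier B; b2 \<in> carrier B; a \<in> carrier A \<rbrakk> \<Longrightarrow>
      l (b1 \<otimes>\<^bsub>B\<^esub> b2) a = (l b1 (l b2 a) \<oplus>\<^bsub>A\<^esub> l b1 (r a b2)) \<ominus>\<^bsub>A\<^esub> r (l b1 a) b2"
    and act6: "\<lbrakk> b1 \<in> carrier B; b2 \<in> carrier B; a \<in> carrier A \<rbrakk> \<Longrightarrow>
      r a (b1 \<otimes>\<^bsub>B\<^esub> b2) = (r (r a b1) b2 \<oplus>\<^bsub>A\<^esub> r (l b1 a) b2) \<ominus>\<^bsub>A\<^esub> l b1 (r a b2)"
    and act7: "\<lbrakk> b1 \<in> carrier B; b2 \<in> carrier B; a \<in> carrier A \<rbrakk> \<Longrightarrow>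
      r (r a b1) b2 = (r a (b1 \<otimes>\<^bsub>B\<^esub> b2) \<oplus>\<^bsub>A\<^esub> r a (b2 \<otimes>\<^bsub>B\<^esub> b1)) \<ominus>\<^bsub>A\<^esub> r (r a b2) b1"
    and act8: "\<lbrakk> b1 \<in> carrier B; b2 \<in> carrier B; a \<in> carrier A \<rbrakk> \<Longrightarrow>
      l b1 (l b2 a) = (l (b1 \<otimes>\<^bsub>B\<^esub> b2) a \<oplus>\<^bsub>A\<^esub> l (b2 \<otimes>\<^bsub>B\<^esub> b1) a) \<ominus>\<^bsub>A\<^esub> l b2 (l b1 a)"

section \<open>The universal strict general actor\<close>

text \<open>
  A pair of maps \<open>f\<close> is represented by \<open>fst f\<close> (the map \<open>a \<mapsto> fa\<close>) and
  \<open>snd f\<close> (the map \<open>a \<mapsto> af\<close>). Both are restricted to the carrier of \<open>A\<close>, so that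
  pairs giving the same maps on \<open>A\<close> are equal.
\<close>

type_synonym 'a map_pair = "('a \<Rightarrow> 'a) \<times> ('a \<Rightarrow> 'a)"

definition action_pair ::
  "('f, 'a, 'n) module_scheme \<Rightarrow> ('b \<Rightarrow> 'a \<Rightarrow> 'a) \<Rightarrow> ('a \<Rightarrow> 'b \<Rightarrow> 'a) \<Rightarrow> 'b \<Rightarrow> 'a map_pair" where
  "action_pair A l r b = (\<lambda>a \<in> carrier A. l b a, \<lambda>a \<in> carrier A. r a b)"

definition pair_zero :: "('f, 'a, 'n) module_scheme \<Rightarrow> 'a map_pair" where
  "pair_zero A = (\<lambda>a \<in> carrier A. \<zero>\<^bsub>A\<^esub>, \<lambda>a \<in> carrier A. \<zero>\<^bsub>A\<^esub>)"

definition pair_add ::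
  "('f, 'a, 'n) module_scheme \<Rightarrow> 'a map_pair \<Rightarrow> 'a map_pair \<Rightarrow> 'a map_pair" where
  "pair_add A f f' =
    (\<lambda>a \<in> carrier A. fst f a \<oplus>\<^bsub>A\<^esub> fst f' a, \<lambda>a \<in> carrier A. snd f a \<oplus>\<^bsub>A\<^esub> snd f' a)"

definition pair_neg :: "('f, 'a, 'n) module_scheme \<Rightarrow> 'a map_pair \<Rightarrow> 'a map_pair" where
  "pair_neg A f = (\<lambda>a \<in> carrier A. \<ominus>\<^bsub>A\<^esub> fst f a, \<lambda>a \<in> carrier A. \<ominus>\<^bsub>A\<^esub> snd f a)"

definition pair_smult ::
  "('f, 'a, 'n) module_scheme \<Rightarrow> 'f \<Rightarrow> 'a map_pair \<Rightarrow> 'a map_pair" where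
  "pair_smult A c f =
    (\<lambda>a \<in> carrier A. c \<odot>\<^bsub>A\<^esub> fst f a, \<lambda>a \<in> carrier A. c \<odot>\<^bsub>A\<^esub> snd f a)"

definition pair_mult ::
  "('f, 'a, 'n) module_scheme \<Rightarrow> 'a map_pair \<Rightarrow> 'a map_pair \<Rightarrow> 'a map_pair" where
  "pair_mult A f f' =
    (\<lambda>a \<in> carrier A. (fst f (fst f' a) \<oplus>\<^bsub>A\<^esub> fst f (snd f' a)) \<ominus>\<^bsub>A\<^esub> snd f' (fst f a),
     \<lambda>a \<in> carrier A. (snd f' (snd f a) \<oplus>\<^bsub>A\<^esub> snd f' (fst f a)) \<ominus>\<^bsub>A\<^esub> fst f (snd f' a))"

text \<open>
  The acting algebras form a proper class, and HOL cannot quantify over types inside a definition.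
  The set of pairs is therefore defined with acting algebras whose carrier is a set of formal
  expressions in one generator. This is no restriction: by
  the lemma \<open>action_pair_in_action_pairs\<close> below, the pair given by an element \<open>b\<close> of an acting
  algebra of any type is already obtained in this way, from a copy of the subalgebra generated
  by \<open>b\<close>.
\<close>

datatype 'f alg_expr =
    Gen
  | Scale 'f "'f alg_expr"
  | Plus "'f alg_expr" "'f alg_expr"
  | Times "'f alg_expr" "'f alg_expr"

definition action_pairs ::
  "('f, 'm) ring_scheme \<Rightarrow> ('f, 'a, 'n) module_scheme \<Rightarrow> 'a map_pair set" where
  "action_pairs F A =
    {action_pair A l r b | (B :: ('f, 'f alg_expr) module) l r b.
       nonassoc_algebra F B \<and> g_alternative B \<and> derived_action F B A l r \<and> b \<in> carrier B}"

inductive_set usga_carrier ::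
  "('f, 'm) ring_scheme \<Rightarrow> ('f, 'a, 'n) module_scheme \<Rightarrow> 'a map_pair set"
  for F :: "('f, 'm) ring_scheme" and A :: "('f, 'a, 'n) module_scheme" where
  base: "f \<in> action_pairs F A \<Longrightarrow> f \<in> usga_carrier F A"
| add: "\<lbrakk> f \<in> usga_carrier F A; f' \<in> usga_carrier F A \<rbrakk> \<Longrightarrow> pair_add A f f' \<in> usga_carrier F A"
| neg: "f \<in> usga_carrier F A \<Longrightarrow> pair_neg A f \<in> usga_carrier F A"
| mult: "\<lbrakk> f \<in> usga_carrier F A; f' \<in> usga_carrier F A \<rbrakk> \<Longrightarrow> pair_mult A f f' \<in> usga_carrier F A"

text \<open>The universal strict general actor of \<open>A\<close>; the unit field is a dummy.\<close>

definition usga ::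
  "('f, 'm) ring_scheme \<Rightarrow> ('f, 'a, 'n) module_scheme \<Rightarrow> ('f, 'a map_pair) module" where
  "usga F A =
    \<lparr> carrier = usga_carrier F A, mult = pair_mult A, one = undefined,
      zero = pair_zero A, add = pair_add A, smult = pair_smult A \<rparr>"

section \<open>Acting algebras of arbitrary type\<close>

primrec alg_eval :: "('f, 'b, 'k) module_scheme \<Rightarrow> 'b \<Rightarrow> 'f alg_expr \<Rightarrow> 'b" where
  "alg_eval B b Gen = b"
| "alg_eval B b (Scale c t) = c \<odot>\<^bsub>B\<^esub> alg_eval B b t"
| "alg_eval B b (Plus s t) = alg_eval B b s \<oplus>\<^bsub>B\<^esub> alg_eval B b t"
| "alg_eval B b (Times s t) = alg_eval B b s \<otimes>\<^bsub>B\<^esub> alg_eval B b t"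

lemma bilinear_mapD:
  assumes "bilinear_map F U V W \<beta>"
  shows "u \<in> carrier U \<Longrightarrow> v \<in> carrier V \<Longrightarrow> \<beta> u v \<in> carrier W"
    and "u \<in> carrier U \<Longrightarrow> u' \<in> carrier U \<Longrightarrow> v \<in> carrier V \<Longrightarrow>
      \<beta> (u \<oplus>\<^bsub>U\<^esub> u') v = \<beta> u v \<oplus>\<^bsub>W\<^esub> \<beta> u' v"
    and "u \<in> carrier U \<Longrightarrow> v \<in> carrier V \<Longrightarrow> v' \<in> carrier V \<Longrightarrow>
      \<beta> u (v \<oplus>\<^bsub>V\<^esub> v') = \<beta> u v \<oplus>\<^bsub>W\<^esub> \<beta> u v'"
    and "c \<in> carrier F \<Longrightarrow> u \<in> carrier U \<Longrightarrow> v \<in> carrier V \<Longrightarrow>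
      \<beta> (c \<odot>\<^bsub>U\<^esub> u) v = c \<odot>\<^bsub>W\<^esub> \<beta> u v"
    and "c \<in> carrier F \<Longrightarrow> u \<in> carrier U \<Longrightarrow> v \<in> carrier V \<Longrightarrow>
      \<beta> u (c \<odot>\<^bsub>V\<^esub> v) = c \<odot>\<^bsub>W\<^esub> \<beta> u v"
  using assms unfolding bilinear_map_def by blast+

lemma action_pair_in_action_pairs:
  fixes F :: "('f, 'm) ring_scheme"
    and A :: "('f, 'a, 'n) module_scheme"
    and B :: "('f, 'b, 'k) module_scheme"
  assumes B: "nonassoc_algebra F B" "g_alternative B"
    and act: "derived_action F B A l r"
    and b: "b \<in> carrier B"
  shows "action_pair A l r b \<in> action_pairs F A"
proof -
  interpret B: nonassoc_algebra F B by (rule B(1))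
  interpret derived_action F B A l r by (rule act)
  note mb = bilinear_mapD[OF B.mult_bilinear]
  note lb = bilinear_mapD[OF l_bilinear]
  note rb = bilinear_mapD[OF r_bilinear]
  define V where "V = {t. set_alg_expr t \<subseteq> carrier F}"
  define e where "e = alg_eval B b"
  define S where "S = e ` V"
  define h where "h = inv_into V e"
  have V: "Gen \<in> V" "c \<in> carrier F \<Longrightarrow> t \<in> V \<Longrightarrow> Scale c t \<in> V"
    "s \<in> V \<Longrightarrow> t \<in> V \<Longrightarrow> Plus s t \<in> V" "s \<in> V \<Longrightarrow> t \<in> V \<Longrightarrow> Times s t \<in> V" for c s t
    unfolding V_def by auto
  have eC: "e t \<in> carrier B" if "t \<in> V" for t
    using that unfolding V_def e_def by (induction t) (auto simp: b mb(1))
  have SC: "x \<in> S \<Longrightarrow> x \<in> carrier B" for x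
    using eC by (auto simp: S_def)
  have e_simps: "e Gen = b" "e (Scale c t) = c \<odot>\<^bsub>B\<^esub> e t"
    "e (Plus t t') = e t \<oplus>\<^bsub>B\<^esub> e t'" "e (Times t t') = e t \<otimes>\<^bsub>B\<^esub> e t'" for c t t'
    by (simp_all add: e_def)
  have bS: "b \<in> S"
    unfolding S_def using V(1) e_simps(1) by (auto intro: rev_image_eqI)
  have Ss: "c \<odot>\<^bsub>B\<^esub> x \<in> S" if c: "c \<in> carrier F" and x: "x \<in> S" for c x
  proof -
    obtain t where "t \<in> V" "x = e t" using x by (auto simp: S_def)
    then show ?thesis unfolding S_def by (intro rev_image_eqI[OF V(2)[OF c, of t]]) (simp_all add: e_simps)
  qed
  have Sa: "x \<oplus>\<^bsub>B\<^esub> y \<in> S" if x: "x \<in> S" and y: "y \<in> S" for x y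
  proof -
    obtain t t' where "t \<in> V" "x = e t" "t' \<in> V" "y = e t'" using x y by (auto simp: S_def)
    then show ?thesis unfolding S_def by (intro rev_image_eqI[OF V(3)[of t t']]) (simp_all add: e_simps)
  qed
  have Sm: "x \<otimes>\<^bsub>B\<^esub> y \<in> S" if x: "x \<in> S" and y: "y \<in> S" for x y
  proof -
    obtain t t' where "t \<in> V" "x = e t" "t' \<in> V" "y = e t'" using x y by (auto simp: S_def)
    then show ?thesis unfolding S_def by (intro rev_image_eqI[OF V(4)[of t t']]) (simp_all add: e_simps)
  qed
  have S0: "\<zero>\<^bsub>B\<^esub> \<in> S"
    using Ss[of "\<zero>\<^bsub>F\<^esub>" b] b bS by simp
  have Sn: "\<ominus>\<^bsub>B\<^esub> x \<in> S" if "x \<in> S" for x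
    using Ss[of "\<ominus>\<^bsub>F\<^esub> \<one>\<^bsub>F\<^esub>" x] that SC by (simp add: B.smult_l_minus)
  have eh: "e (h x) = x" if "x \<in> S" for x
    using that unfolding S_def h_def by (rule f_inv_into_f)
  define C :: "('f, 'f alg_expr) module" where
    "C = \<lparr> carrier = h ` S, mult = (\<lambda>x y. h (e x \<otimes>\<^bsub>B\<^esub> e y)), one = undefined,
      zero = h \<zero>\<^bsub>B\<^esub>, add = (\<lambda>x y. h (e x \<oplus>\<^bsub>B\<^esub> e y)), smult = (\<lambda>c x. h (c \<odot>\<^bsub>B\<^esub> e x)) \<rparr>"
  have C: "carrier C = h ` S" "mult C x y = h (e x \<otimes>\<^bsub>B\<^esub> e y)" "zero C = h \<zero>\<^bsub>B\<^esub>"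
    "add C x y = h (e x \<oplus>\<^bsub>B\<^esub> e y)" "smult C c x = h (c \<odot>\<^bsub>B\<^esub> e x)" for x y c
    by (simp_all add: C_def)
  have ab: "abelian_group C"
  proof (rule abelian_groupI)
    fix x assume "x \<in> carrier C"
    then obtain s where s: "s \<in> S" "x = h s" by (auto simp: C)
    show "\<exists>y \<in> carrier C. y \<oplus>\<^bsub>C\<^esub> x = \<zero>\<^bsub>C\<^esub>"
      using s Sn SC by (intro bexI[of _ "h (\<ominus>\<^bsub>B\<^esub> s)"]) (auto simp: C eh B.M.l_neg)
  qed (auto simp: C eh Sa S0 SC B.M.a_ac)
  have mod: "module F C"
    by (rule moduleI)
      (auto simp: C eh Sa Ss SC ab B.cring_axioms B.smult_l_distr B.smult_r_distr B.smult_assoc1)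
  have bil: "bilinear_map F C C C (mult C)"
    unfolding bilinear_map_def by (auto simp: C eh Sa Ss Sm SC mb)
  have algC: "nonassoc_algebra F C"
    using mod bil B.field_axioms
    by (simp add: nonassoc_algebra_def nonassoc_algebra_axioms_def)
  have neg: "\<ominus>\<^bsub>C\<^esub> h s = h (\<ominus>\<^bsub>B\<^esub> s)" if "s \<in> S" for s
  proof -
    interpret C: abelian_group C by (rule ab)
    have "h (\<ominus>\<^bsub>B\<^esub> s) \<oplus>\<^bsub>C\<^esub> h s = \<zero>\<^bsub>C\<^esub>"
      using that by (simp add: C eh Sn SC B.M.l_neg)
    moreover have "h s \<in> carrier C" "h (\<ominus>\<^bsub>B\<^esub> s) \<in> carrier C"
      using that Sn by (auto simp: C)
    ultimately show ?thesis by (metis C.minus_equality)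
  qed
  have minus: "h s \<ominus>\<^bsub>C\<^esub> h t = h (s \<ominus>\<^bsub>B\<^esub> t)" if "s \<in> S" "t \<in> S" for s t
    using that by (simp add: a_minus_def neg C(4) eh Sn)
  have hm: "h s \<otimes>\<^bsub>C\<^esub> h t = h (s \<otimes>\<^bsub>B\<^esub> t)" and ha: "h s \<oplus>\<^bsub>C\<^esub> h t = h (s \<oplus>\<^bsub>B\<^esub> t)"
    if "s \<in> S" "t \<in> S" for s t
    using that by (simp_all add: C eh)
  have ga: "g_alternative C"
    unfolding g_alternative_def
  proof (intro ballI)
    fix x y z assume "x \<in> carrier C" "y \<in> carrier C" "z \<in> carrier C"
    then obtain s t u where *: "s \<in> S" "x = h s" "t \<in> S" "y = h t" "u \<in> S" "z = h u"
      by (auto simp: C)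
    have "s \<in> carrier B" "t \<in> carrier B" "u \<in> carrier B" using * SC by auto
    then have eqs: "s \<otimes>\<^bsub>B\<^esub> (t \<otimes>\<^bsub>B\<^esub> u) =
        ((s \<otimes>\<^bsub>B\<^esub> t) \<otimes>\<^bsub>B\<^esub> u \<oplus>\<^bsub>B\<^esub> (t \<otimes>\<^bsub>B\<^esub> s) \<otimes>\<^bsub>B\<^esub> u) \<ominus>\<^bsub>B\<^esub> t \<otimes>\<^bsub>B\<^esub> (s \<otimes>\<^bsub>B\<^esub> u)"
      "(s \<otimes>\<^bsub>B\<^esub> t) \<otimes>\<^bsub>B\<^esub> u =
        (s \<otimes>\<^bsub>B\<^esub> (t \<otimes>\<^bsub>B\<^esub> u) \<oplus>\<^bsub>B\<^esub> s \<otimes>\<^bsub>B\<^esub> (u \<otimes>\<^bsub>B\<^esub> t)) \<ominus>\<^bsub>B\<^esub> (s \<otimes>\<^bsub>B\<^esub> u) \<otimes>\<^bsub>B\<^esub> t"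
      using B(2) unfolding g_alternative_def by blast+
    show "x \<otimes>\<^bsub>C\<^esub> (y \<otimes>\<^bsub>C\<^esub> z) =
         ((x \<otimes>\<^bsub>C\<^esub> y) \<otimes>\<^bsub>C\<^esub> z \<oplus>\<^bsub>C\<^esub> (y \<otimes>\<^bsub>C\<^esub> x) \<otimes>\<^bsub>C\<^esub> z) \<ominus>\<^bsub>C\<^esub> y \<otimes>\<^bsub>C\<^esub> (x \<otimes>\<^bsub>C\<^esub> z) \<and>
       (x \<otimes>\<^bsub>C\<^esub> y) \<otimes>\<^bsub>C\<^esub> z =
         (x \<otimes>\<^bsub>C\<^esub> (y \<otimes>\<^bsub>C\<^esub> z) \<oplus>\<^bsub>C\<^esub> x \<otimes>\<^bsub>C\<^esub> (z \<otimes>\<^bsub>C\<^esub> y)) \<ominus>\<^bsub>C\<^esub> (x \<otimes>\<^bsub>C\<^esub> z) \<otimes>\<^bsub>C\<^esub> y"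
      by (simp (no_asm) only: * hm ha minus Sm Sa) (intro conjI arg_cong[of _ _ h] eqs)
  qed
  have eC': "e x \<in> carrier B" if "x \<in> carrier C" for x
    using that by (auto simp: C eh SC)
  have eM: "e (x \<otimes>\<^bsub>C\<^esub> y) = e x \<otimes>\<^bsub>B\<^esub> e y" if "x \<in> carrier C" "y \<in> carrier C" for x y
    using that by (auto simp: C eh Sm)
  have actC: "derived_action F C A (\<lambda>x. l (e x)) (\<lambda>a x. r a (e x))"
  proof (unfold_locales, goal_cases)
    case 1 show ?case unfolding bilinear_map_def by (auto simp: C eh Sa Ss SC lb)
  next
    case 2 show ?case unfolding bilinear_map_def by (auto simp: C eh Sa Ss SC rb)
  next
    case (3 x a1 a2) then show ?case by (intro act1 eC')
  next
    case (4 x a1 a2) then show ?case by (intro act2 eC')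
  next
    case (5 x a1 a2) then show ?case by (intro act3 eC')
  next
    case (6 x a1 a2) then show ?case by (intro act4 eC')
  next
    case (7 x y a) then show ?case by (simp only: eM) (intro act5 eC')
  next
    case (8 x y a) then show ?case by (simp only: eM) (intro act6 eC')
  next
    case (9 x y a) then show ?case by (simp only: eM) (intro act7 eC')
  next
    case (10 x y a) then show ?case by (simp only: eM) (intro act8 eC')
  qed
  have "action_pair A l r b = action_pair A (\<lambda>x. l (e x)) (\<lambda>a x. r a (e x)) (h b)"
    by (simp add: action_pair_def eh bS)
  moreover have "h b \<in> carrier C" using bS by (simp add: C)
  ultimately show ?thesis
    unfolding action_pairs_def using algC ga actC by blast
qed

end

theory Submission
  imports Defs
begin

text \<open>
  For an element \<open>b\<close> acting on \<open>A\<close>, anticommutativity turns the action identities into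
  \<open>b(xy) = (xb)y = x(yb)\<close> and \<open>(xy)b = x(by) = (bx)y\<close>. Evaluating \<open>(xb)(yz)\<close> in two ways then
  gives \<open>x(y(bz)) = x(y(zb))\<close>, so \<open>bz = zb\<close> because \<open>Ann A = 0\<close>. Hence every acting pair has the
  form \<open>(f, f)\<close> with \<open>f\<close> in the centroid of \<open>A\<close>. The centroid is commutative when \<open>Ann A = 0\<close>,
  so on such pairs the product is \<open>ff' + ff' - f'f = ff'\<close>, that is, composition of maps.
\<close>

section \<open>Arithmetic in an anticommutative algebra with zero annihilator\<close>

locale faithful_anticomm_galt = nonassoc_algebra F A
  for F :: "('f, 'm) ring_scheme" (structure)
    and A :: "('f, 'a, 'n) module_scheme" (structure) +
  assumes galt: "g_alternative A"
    and anticomm: "anticommutative A"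
    and ann: "Ann A = {\<zero>\<^bsub>A\<^esub>}"
begin

lemmas mult_closed = bilinear_mapD(1)[OF mult_bilinear]
  and mult_add_left = bilinear_mapD(2)[OF mult_bilinear]
  and mult_add_right = bilinear_mapD(3)[OF mult_bilinear]
  and mult_smult_left = bilinear_mapD(4)[OF mult_bilinear]
  and mult_smult_right = bilinear_mapD(5)[OF mult_bilinear]

lemma anti: "x \<in> carrier A \<Longrightarrow> y \<in> carrier A \<Longrightarrow> x \<otimes>\<^bsub>A\<^esub> y = \<ominus>\<^bsub>A\<^esub> (y \<otimes>\<^bsub>A\<^esub> x)"
  using anticomm unfolding anticommutative_def by blast

lemma anti_sum: "x \<in> carrier A \<Longrightarrow> y \<in> carrier A \<Longrightarrow> x \<otimes>\<^bsub>A\<^esub> y \<oplus>\<^bsub>A\<^esub> y \<otimes>\<^bsub>A\<^esub> x = \<zero>\<^bsub>A\<^esub>"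
  using anti[of x y] by (simp add: mult_closed M.l_neg)

text \<open>Stated for a bare function, because it serves both the multiplications by a fixed
  element and the two maps given by an acting element.\<close>

lemma additive_zero:
  assumes "\<And>x. x \<in> carrier A \<Longrightarrow> f x \<in> carrier A"
    and "\<And>x y. x \<in> carrier A \<Longrightarrow> y \<in> carrier A \<Longrightarrow> f (x \<oplus>\<^bsub>A\<^esub> y) = f x \<oplus>\<^bsub>A\<^esub> f y"
  shows "f \<zero>\<^bsub>A\<^esub> = \<zero>\<^bsub>A\<^esub>"
proof -
  have "f \<zero>\<^bsub>A\<^esub> \<oplus>\<^bsub>A\<^esub> f \<zero>\<^bsub>A\<^esub> = f \<zero>\<^bsub>A\<^esub>"
    using assms(2)[of "\<zero>\<^bsub>A\<^esub>" "\<zero>\<^bsub>A\<^esub>"] by simp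
  then show ?thesis
    using assms(1) M.zero_closed M.add.l_cancel_one by blast
qed

lemma additive_neg:
  assumes f: "\<And>x. x \<in> carrier A \<Longrightarrow> f x \<in> carrier A"
    and add: "\<And>x y. x \<in> carrier A \<Longrightarrow> y \<in> carrier A \<Longrightarrow> f (x \<oplus>\<^bsub>A\<^esub> y) = f x \<oplus>\<^bsub>A\<^esub> f y"
    and x: "x \<in> carrier A"
  shows "f (\<ominus>\<^bsub>A\<^esub> x) = \<ominus>\<^bsub>A\<^esub> f x"
proof -
  have "f (\<ominus>\<^bsub>A\<^esub> x) \<oplus>\<^bsub>A\<^esub> f x = f (\<ominus>\<^bsub>A\<^esub> x \<oplus>\<^bsub>A\<^esub> x)"
    using add x by simp
  also have "\<dots> = \<zero>\<^bsub>A\<^esub>"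
    using x additive_zero[of f, OF f add] by (simp add: M.l_neg)
  finally show ?thesis
    using f x by (metis M.add.inv_closed M.minus_equality)
qed

lemma mult_zero_left: "x \<in> carrier A \<Longrightarrow> \<zero>\<^bsub>A\<^esub> \<otimes>\<^bsub>A\<^esub> x = \<zero>\<^bsub>A\<^esub>"
  using additive_zero[of "\<lambda>y. y \<otimes>\<^bsub>A\<^esub> x"] mult_closed mult_add_left by blast

lemma mult_zero_right: "x \<in> carrier A \<Longrightarrow> x \<otimes>\<^bsub>A\<^esub> \<zero>\<^bsub>A\<^esub> = \<zero>\<^bsub>A\<^esub>"
  using additive_zero[of "\<lambda>y. x \<otimes>\<^bsub>A\<^esub> y"] mult_closed mult_add_right by blast

lemma mult_neg_left: "x \<in> carrier A \<Longrightarrow> y \<in> carrier A \<Longrightarrow> (\<ominus>\<^bsub>A\<^esub> y) \<otimes>\<^bsub>A\<^esub> x = \<ominus>\<^bsub>A\<^esub> (y \<otimes>\<^bsub>A\<^esub> x)"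
  using additive_neg[of "\<lambda>y. y \<otimes>\<^bsub>A\<^esub> x" y] mult_closed mult_add_left by blast

lemma mult_neg_right: "x \<in> carrier A \<Longrightarrow> y \<in> carrier A \<Longrightarrow> x \<otimes>\<^bsub>A\<^esub> (\<ominus>\<^bsub>A\<^esub> y) = \<ominus>\<^bsub>A\<^esub> (x \<otimes>\<^bsub>A\<^esub> y)"
  using additive_neg[of "\<lambda>y. x \<otimes>\<^bsub>A\<^esub> y" y] mult_closed mult_add_right by blast

text \<open>The right-hand sides of \<open>act1\<close> and \<open>act2\<close>, and the product of
  two pairs, all take this shape once their outer terms are known to agree.\<close>

lemma add_diff_cancel_left:
  "x \<in> carrier A \<Longrightarrow> y \<in> carrier A \<Longrightarrow> (x \<oplus>\<^bsub>A\<^esub> y) \<ominus>\<^bsub>A\<^esub> x = y"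
  by (simp add: a_minus_def M.a_comm[of x y] M.a_assoc M.r_neg)

text \<open>The difference x - y is killed by every left factor, and by anticommutativity also by
  every right factor, so it lies in \<open>Ann A\<close>. Later equalities in \<open>A\<close> are
  proved by multiplying from the left and then cancelling the factor.\<close>

lemma faithful:
  assumes x: "x \<in> carrier A" and y: "y \<in> carrier A"
    and eq: "\<And>a. a \<in> carrier A \<Longrightarrow> a \<otimes>\<^bsub>A\<^esub> x = a \<otimes>\<^bsub>A\<^esub> y"
  shows "x = y"
proof -
  have 0: "a \<otimes>\<^bsub>A\<^esub> (x \<ominus>\<^bsub>A\<^esub> y) = \<zero>\<^bsub>A\<^esub>" if a: "a \<in> carrier A" for a
    using eq[OF a] a x y
    by (simp add: a_minus_def mult_add_right mult_neg_right mult_closed M.r_neg)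
  have "(x \<ominus>\<^bsub>A\<^esub> y) \<otimes>\<^bsub>A\<^esub> a = \<zero>\<^bsub>A\<^esub>" if a: "a \<in> carrier A" for a
    using anti[of "x \<ominus>\<^bsub>A\<^esub> y" a] 0[OF a] a x y by simp
  with 0 have "x \<ominus>\<^bsub>A\<^esub> y \<in> Ann A"
    using x y unfolding Ann_def by auto
  then have "x \<oplus>\<^bsub>A\<^esub> \<ominus>\<^bsub>A\<^esub> y = \<zero>\<^bsub>A\<^esub>"
    using ann by (simp add: a_minus_def)
  then show ?thesis
    using x y by (metis M.add.inv_closed M.minus_equality M.minus_minus)
qed

text \<open>In the first g-alternative identity the bracket (xy)z + (yx)z equals (xy + yx)z, which
  vanishes by anticommutativity.\<close>

lemma swap_left:
  assumes "x \<in> carrier A" "y \<in> carrier A" "z \<in> carrier A"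
  shows "x \<otimes>\<^bsub>A\<^esub> (y \<otimes>\<^bsub>A\<^esub> z) = \<ominus>\<^bsub>A\<^esub> (y \<otimes>\<^bsub>A\<^esub> (x \<otimes>\<^bsub>A\<^esub> z))"
proof -
  have "x \<otimes>\<^bsub>A\<^esub> (y \<otimes>\<^bsub>A\<^esub> z) =
      ((x \<otimes>\<^bsub>A\<^esub> y) \<otimes>\<^bsub>A\<^esub> z \<oplus>\<^bsub>A\<^esub> (y \<otimes>\<^bsub>A\<^esub> x) \<otimes>\<^bsub>A\<^esub> z) \<ominus>\<^bsub>A\<^esub> y \<otimes>\<^bsub>A\<^esub> (x \<otimes>\<^bsub>A\<^esub> z)"
    using galt assms unfolding g_alternative_def by blast
  also have "(x \<otimes>\<^bsub>A\<^esub> y) \<otimes>\<^bsub>A\<^esub> z \<oplus>\<^bsub>A\<^esub> (y \<otimes>\<^bsub>A\<^esub> x) \<otimes>\<^bsub>A\<^esub> z = \<zero>\<^bsub>A\<^esub>"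
    using assms
    by (simp add: mult_add_left[symmetric] mult_closed anti_sum mult_zero_left)
  finally show ?thesis
    using assms by (simp add: a_minus_def mult_closed)
qed

section \<open>The centroid of \<open>A\<close> and its commutativity\<close>

text \<open>The classical centroid: linear maps that commute with all left and right
  multiplications. The extensional function space matches the restricted components of the pairs, so
  that equality on the carrier is equality of functions.\<close>

definition centroid :: "('a \<Rightarrow> 'a) set" where
  "centroid = {f \<in> carrier A \<rightarrow>\<^sub>E carrier A.
    (\<forall>x \<in> carrier A. \<forall>y \<in> carrier A. f (x \<oplus>\<^bsub>A\<^esub> y) = f x \<oplus>\<^bsub>A\<^esub> f y) \<and>
    (\<forall>c \<in> carrier F. \<forall>x \<in> carrier A. f (c \<odot>\<^bsub>A\<^esub> x) = c \<odot>\<^bsub>A\<^esub> f x) \<and>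
    (\<forall>x \<in> carrier A. \<forall>y \<in> carrier A.
       f (x \<otimes>\<^bsub>A\<^esub> y) = f x \<otimes>\<^bsub>A\<^esub> y \<and> f (x \<otimes>\<^bsub>A\<^esub> y) = x \<otimes>\<^bsub>A\<^esub> f y)}"

lemma centroidD:
  assumes "f \<in> centroid"
  shows "x \<in> carrier A \<Longrightarrow> f x \<in> carrier A"
    and "x \<in> carrier A \<Longrightarrow> y \<in> carrier A \<Longrightarrow> f (x \<oplus>\<^bsub>A\<^esub> y) = f x \<oplus>\<^bsub>A\<^esub> f y"
    and "c \<in> carrier F \<Longrightarrow> x \<in> carrier A \<Longrightarrow> f (c \<odot>\<^bsub>A\<^esub> x) = c \<odot>\<^bsub>A\<^esub> f x"
    and "x \<in> carrier A \<Longrightarrow> y \<in> carrier A \<Longrightarrow> f (x \<otimes>\<^bsub>A\<^esub> y) = f x \<otimes>\<^bsub>A\<^esub> y"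
    and "x \<in> carrier A \<Longrightarrow> y \<in> carrier A \<Longrightarrow> f (x \<otimes>\<^bsub>A\<^esub> y) = x \<otimes>\<^bsub>A\<^esub> f y"
    and "restrict f (carrier A) = f"
  using assms unfolding centroid_def
  by (blast | simp add: PiE_mem extensional_restrict PiE_def)+

lemma restrict_centroidI:
  assumes "\<And>x. x \<in> carrier A \<Longrightarrow> f x \<in> carrier A"
    and "\<And>x y. x \<in> carrier A \<Longrightarrow> y \<in> carrier A \<Longrightarrow> f (x \<oplus>\<^bsub>A\<^esub> y) = f x \<oplus>\<^bsub>A\<^esub> f y"
    and "\<And>c x. c \<in> carrier F \<Longrightarrow> x \<in> carrier A \<Longrightarrow> f (c \<odot>\<^bsub>A\<^esub> x) = c \<odot>\<^bsub>A\<^esub> f x"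
    and "\<And>x y. x \<in> carrier A \<Longrightarrow> y \<in> carrier A \<Longrightarrow> f (x \<otimes>\<^bsub>A\<^esub> y) = f x \<otimes>\<^bsub>A\<^esub> y"
    and "\<And>x y. x \<in> carrier A \<Longrightarrow> y \<in> carrier A \<Longrightarrow> f (x \<otimes>\<^bsub>A\<^esub> y) = x \<otimes>\<^bsub>A\<^esub> f y"
  shows "restrict f (carrier A) \<in> centroid"
  \<comment> \<open>Read forwards, the two product rules share the left-hand side f(xy); reversed,
    they rewrite both (fx)y and x(fy) to this common value.\<close>
  using assms(1-3) assms(4)[symmetric] assms(5)[symmetric]
  by (auto simp: centroid_def mult_closed)

text \<open>In the product a(f(gx)) the map f is moved onto the left factor, g is pulled out, f is
  moved back to the right factor and g follows. Then a is cancelled by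
  \<open>faithful\<close>.\<close>

lemma centroid_commute:
  assumes f: "f \<in> centroid" and g: "g \<in> centroid" and x: "x \<in> carrier A"
  shows "f (g x) = g (f x)"
proof (rule faithful)
  fix a assume a: "a \<in> carrier A"
  have "a \<otimes>\<^bsub>A\<^esub> f (g x) = f (a \<otimes>\<^bsub>A\<^esub> g x)"
    using a x f g by (metis centroidD(1,5))
  also have "\<dots> = f a \<otimes>\<^bsub>A\<^esub> g x"
    using a x f g by (metis centroidD(1,4))
  also have "\<dots> = g (f a \<otimes>\<^bsub>A\<^esub> x)"
    using a x f g by (metis centroidD(1,5))
  also have "\<dots> = g (a \<otimes>\<^bsub>A\<^esub> f x)"
    using a x f by (metis centroidD(4,5))
  also have "\<dots> = a \<otimes>\<^bsub>A\<^esub> g (f x)"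
    using a x f g by (metis centroidD(1,5))
  finally show "a \<otimes>\<^bsub>A\<^esub> f (g x) = a \<otimes>\<^bsub>A\<^esub> g (f x)" .
qed (use assms in \<open>auto intro: centroidD(1)\<close>)

section \<open>Acting elements give centroid maps\<close>

lemma acting_pair:
  fixes B :: "('f, 'b, 'k) module_scheme"
  assumes act: "derived_action F B A l r" and b: "b \<in> carrier B"
  shows "x \<in> carrier A \<Longrightarrow> r x b = l b x"
    and "restrict (l b) (carrier A) \<in> centroid"
proof -
  interpret derived_action F B A l r by (rule act)
  define L where "L = l b"
  define R where "R x = r x b" for x
  note lb = bilinear_mapD[OF l_bilinear]
  note rb = bilinear_mapD[OF r_bilinear]
  have L: "L x \<in> carrier A" if "x \<in> carrier A" for x
    using lb(1)[OF b that] by (simp add: L_def)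
  have R: "R x \<in> carrier A" if "x \<in> carrier A" for x
    using rb(1)[OF that b] by (simp add: R_def)
  have Ladd: "L (x \<oplus>\<^bsub>A\<^esub> y) = L x \<oplus>\<^bsub>A\<^esub> L y" if "x \<in> carrier A" "y \<in> carrier A" for x y
    using lb(3)[OF b that] by (simp add: L_def)
  have Radd: "R (x \<oplus>\<^bsub>A\<^esub> y) = R x \<oplus>\<^bsub>A\<^esub> R y" if "x \<in> carrier A" "y \<in> carrier A" for x y
    using rb(2)[OF that b] by (simp add: R_def)
  note zero = additive_zero[of L, OF L Ladd] additive_zero[of R, OF R Radd]
  have LL: "L x \<otimes>\<^bsub>A\<^esub> y = x \<otimes>\<^bsub>A\<^esub> L y" if x: "x \<in> carrier A" and y: "y \<in> carrier A" for x y
  proof -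
    \<comment> \<open>Additivity merges the first two terms of \<open>act3\<close> into the value of
      \<open>L\<close> at xy + yx = 0. What remains is -(Ly)x, which is x(Ly).\<close>
    have "L x \<otimes>\<^bsub>A\<^esub> y = L (x \<otimes>\<^bsub>A\<^esub> y \<oplus>\<^bsub>A\<^esub> y \<otimes>\<^bsub>A\<^esub> x) \<ominus>\<^bsub>A\<^esub> L y \<otimes>\<^bsub>A\<^esub> x"
      using act3[OF b x y] x y by (simp add: Ladd mult_closed) (simp add: L_def)
    then show ?thesis
      using x y anti[of x "L y"] by (simp add: anti_sum zero a_minus_def mult_closed L)
  qed
  have RR: "x \<otimes>\<^bsub>A\<^esub> R y = R x \<otimes>\<^bsub>A\<^esub> y" if x: "x \<in> carrier A" and y: "y \<in> carrier A" for x y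
  proof -
    \<comment> \<open>The same argument for \<open>R\<close>, starting from
      \<open>act4\<close>.\<close>
    have "x \<otimes>\<^bsub>A\<^esub> R y = R (x \<otimes>\<^bsub>A\<^esub> y \<oplus>\<^bsub>A\<^esub> y \<otimes>\<^bsub>A\<^esub> x) \<ominus>\<^bsub>A\<^esub> y \<otimes>\<^bsub>A\<^esub> R x"
      using act4[OF b x y] x y by (simp add: Radd mult_closed) (simp add: R_def)
    then show ?thesis
      using x y anti[of "R x" y] by (simp add: anti_sum zero a_minus_def mult_closed R)
  qed
  \<comment> \<open>By \<open>LL\<close> the first and last terms of \<open>act1\<close> cancel; in
    \<open>RL\<close> below, \<open>RR\<close> does the same for \<open>act2\<close>.\<close>
  have LR: "L (x \<otimes>\<^bsub>A\<^esub> y) = R x \<otimes>\<^bsub>A\<^esub> y" if x: "x \<in> carrier A" and y: "y \<in> carrier A" for x y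
    using act1[OF b x y] LL[OF x y] x y
    by (simp add: L_def[symmetric] R_def[symmetric] add_diff_cancel_left mult_closed L R)
  have RL: "R (x \<otimes>\<^bsub>A\<^esub> y) = x \<otimes>\<^bsub>A\<^esub> L y" if x: "x \<in> carrier A" and y: "y \<in> carrier A" for x y
    using act2[OF b x y] RR[OF x y] x y
    by (simp add: L_def[symmetric] R_def[symmetric] add_diff_cancel_left mult_closed L R)
  have eq: "R z = L z" if z: "z \<in> carrier A" for z
  proof (rule faithful)
    fix y assume y: "y \<in> carrier A"
    \<comment> \<open>A second left factor x is introduced, since \<open>swap_left\<close> needs
      three factors.\<close>
    show "y \<otimes>\<^bsub>A\<^esub> R z = y \<otimes>\<^bsub>A\<^esub> L z"
    proof (rule faithful)
      fix x assume x: "x \<in> carrier A"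
      \<comment> \<open>\<open>swap_left\<close> brings x next to Rz, \<open>RR\<close> shifts
        \<open>R\<close> from z to x, and a second swap restores the order and removes the sign.
        Then \<open>RR\<close> shifts \<open>R\<close> onto the product yz, where \<open>RL\<close>
        turns it into \<open>L\<close>.\<close>
      have "x \<otimes>\<^bsub>A\<^esub> (y \<otimes>\<^bsub>A\<^esub> R z) = \<ominus>\<^bsub>A\<^esub> (y \<otimes>\<^bsub>A\<^esub> (R x \<otimes>\<^bsub>A\<^esub> z))"
        using x y z by (simp add: swap_left[of x y] RR[of x] R)
      also have "\<dots> = R x \<otimes>\<^bsub>A\<^esub> (y \<otimes>\<^bsub>A\<^esub> z)"
        using x y z swap_left[of "R x" y z] by (simp add: R)
      also have "\<dots> = x \<otimes>\<^bsub>A\<^esub> (y \<otimes>\<^bsub>A\<^esub> L z)"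
        using x y z by (simp add: RR[symmetric] RL mult_closed)
      finally show "x \<otimes>\<^bsub>A\<^esub> (y \<otimes>\<^bsub>A\<^esub> R z) = x \<otimes>\<^bsub>A\<^esub> (y \<otimes>\<^bsub>A\<^esub> L z)" .
    qed (use y z in \<open>auto intro: mult_closed L R\<close>)
  qed (use z in \<open>auto intro: L R\<close>)
  then show "r x b = l b x" if "x \<in> carrier A"
    using that by (simp add: L_def R_def)
  have smult: "L (c \<odot>\<^bsub>A\<^esub> x) = c \<odot>\<^bsub>A\<^esub> L x" if "c \<in> carrier F" "x \<in> carrier A" for c x
    using lb(5)[OF that(1) b that(2)] by (simp add: L_def)
  \<comment> \<open>Once \<open>R\<close> and \<open>L\<close> agree, \<open>LR\<close> is the left
    centroid law, and \<open>LL\<close> converts it into the right one.\<close>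
  have "restrict L (carrier A) \<in> centroid"
    by (rule restrict_centroidI) (simp_all add: L Ladd smult LR eq LL)
  then show "restrict (l b) (carrier A) \<in> centroid"
    by (simp add: L_def)
qed

section \<open>Operations on pairs of equal centroid maps\<close>

text \<open>The second component of the product collapses to g(fx) rather than f(gx), so
  \<open>centroid_commute\<close> is also what makes the two components coincide again.\<close>

lemma pair_mult_centroid:
  assumes f: "f \<in> centroid" and g: "g \<in> centroid"
  shows "pair_mult A (f, f) (g, g) = (restrict (f \<circ> g) (carrier A), restrict (f \<circ> g) (carrier A))"
  unfolding pair_mult_def
  using centroid_commute[OF f g] centroidD(1)[OF f] centroidD(1)[OF g]
  by (auto simp: add_diff_cancel_left intro!: restrict_ext)

lemma centroid_comp:
  assumes "f \<in> centroid" "g \<in> centroid"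
  shows "restrict (f \<circ> g) (carrier A) \<in> centroid"
proof (rule restrict_centroidI)
  fix x y assume "x \<in> carrier A" "y \<in> carrier A"
  then show "(f \<circ> g) (x \<otimes>\<^bsub>A\<^esub> y) = (f \<circ> g) x \<otimes>\<^bsub>A\<^esub> y"
    and "(f \<circ> g) (x \<otimes>\<^bsub>A\<^esub> y) = x \<otimes>\<^bsub>A\<^esub> (f \<circ> g) y"
    by (simp add: centroidD(1,4)[OF assms(1)] centroidD(1,4)[OF assms(2)],
        simp add: centroidD(1,5)[OF assms(1)] centroidD(1,5)[OF assms(2)])
qed (simp_all add: centroidD(1-3)[OF assms(1)] centroidD(1-3)[OF assms(2)])

lemma centroid_add:
  assumes "f \<in> centroid" "g \<in> centroid"
  shows "(\<lambda>x \<in> carrier A. f x \<oplus>\<^bsub>A\<^esub> g x) \<in> centroid"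
proof (rule restrict_centroidI)
  fix x y assume "x \<in> carrier A" "y \<in> carrier A"
  then show "f (x \<otimes>\<^bsub>A\<^esub> y) \<oplus>\<^bsub>A\<^esub> g (x \<otimes>\<^bsub>A\<^esub> y) = (f x \<oplus>\<^bsub>A\<^esub> g x) \<otimes>\<^bsub>A\<^esub> y"
    and "f (x \<otimes>\<^bsub>A\<^esub> y) \<oplus>\<^bsub>A\<^esub> g (x \<otimes>\<^bsub>A\<^esub> y) = x \<otimes>\<^bsub>A\<^esub> (f y \<oplus>\<^bsub>A\<^esub> g y)"
    by (simp add: centroidD(1,4)[OF assms(1)] centroidD(1,4)[OF assms(2)] mult_add_left,
        simp add: centroidD(1,5)[OF assms(1)] centroidD(1,5)[OF assms(2)] mult_add_right)
qed (simp_all add: centroidD(1-3)[OF assms(1)] centroidD(1-3)[OF assms(2)] smult_r_distr M.a_ac)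

lemma centroid_neg:
  assumes "f \<in> centroid"
  shows "(\<lambda>x \<in> carrier A. \<ominus>\<^bsub>A\<^esub> f x) \<in> centroid"
proof (rule restrict_centroidI)
  fix x y assume "x \<in> carrier A" "y \<in> carrier A"
  then show "\<ominus>\<^bsub>A\<^esub> f (x \<otimes>\<^bsub>A\<^esub> y) = (\<ominus>\<^bsub>A\<^esub> f x) \<otimes>\<^bsub>A\<^esub> y"
    and "\<ominus>\<^bsub>A\<^esub> f (x \<otimes>\<^bsub>A\<^esub> y) = x \<otimes>\<^bsub>A\<^esub> (\<ominus>\<^bsub>A\<^esub> f y)"
    by (simp add: centroidD(1,4)[OF assms] mult_neg_left,
        simp add: centroidD(1,5)[OF assms] mult_neg_right)
qed (simp_all add: centroidD(1-3)[OF assms] smult_r_minus M.minus_add)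

lemma centroid_smult:
  assumes "c \<in> carrier F" "f \<in> centroid"
  shows "(\<lambda>x \<in> carrier A. c \<odot>\<^bsub>A\<^esub> f x) \<in> centroid"
proof (rule restrict_centroidI)
  fix x y assume "x \<in> carrier A" "y \<in> carrier A"
  then show "c \<odot>\<^bsub>A\<^esub> f (x \<otimes>\<^bsub>A\<^esub> y) = (c \<odot>\<^bsub>A\<^esub> f x) \<otimes>\<^bsub>A\<^esub> y"
    and "c \<odot>\<^bsub>A\<^esub> f (x \<otimes>\<^bsub>A\<^esub> y) = x \<otimes>\<^bsub>A\<^esub> (c \<odot>\<^bsub>A\<^esub> f y)"
    by (simp add: assms(1) centroidD(1,4)[OF assms(2)] mult_smult_left,
        simp add: assms(1) centroidD(1,5)[OF assms(2)] mult_smult_right)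
next
  \<comment> \<open>Moving d past c uses commutativity of the multiplication in
    \<open>F\<close>.\<close>
  fix d x assume "d \<in> carrier F" "x \<in> carrier A"
  then show "c \<odot>\<^bsub>A\<^esub> f (d \<odot>\<^bsub>A\<^esub> x) = d \<odot>\<^bsub>A\<^esub> (c \<odot>\<^bsub>A\<^esub> f x)"
    by (simp add: assms(1) centroidD(1,3)[OF assms(2)] smult_assoc1[symmetric] m_comm)
qed (simp_all add: assms(1) centroidD(1,2)[OF assms(2)] smult_r_distr)

section \<open>The elements of the actor and its closure under scalars\<close>

text \<open>The generators are handled by \<open>acting_pair\<close>, and the centroid is closed
  under sums, negatives and composition. Every identity in the actor thereby reduces to one between
  maps in the centroid.\<close>

lemma usga_centroid: "p \<in> usga_carrier F A \<Longrightarrow> \<exists>f \<in> centroid. p = (f, f)"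
proof (induction rule: usga_carrier.induct)
  case (base p)
  then obtain B :: "('f, 'f alg_expr) module" and l r b
    where act: "derived_action F B A l r" "b \<in> carrier B" and p: "p = action_pair A l r b"
    unfolding action_pairs_def by blast
  have "p = (restrict (l b) (carrier A), restrict (l b) (carrier A))"
    using acting_pair(1)[OF act] by (auto simp: p action_pair_def intro!: restrict_ext)
  then show ?case
    using acting_pair(2)[OF act] by (rule bexI)
next
  case (add p q)
  then show ?case
    using centroid_add by (auto simp: pair_add_def)
next
  case (neg p)
  then show ?case
    using centroid_neg by (auto simp: pair_neg_def)
next
  case (mult p q)
  then obtain f g where "f \<in> centroid" "g \<in> centroid" "p = (f, f)" "q = (g, g)"
    by blast
  then show ?case
    using pair_mult_centroid centroid_comp by blast
qed

text \<open>With both actions equal to the multiplication, \<open>act1\<close>, \<open>act4\<close>,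
  \<open>act6\<close> and \<open>act8\<close> are instances of the first g-alternative identity, the
  other four of the second. This supplies a concrete acting algebra, from which the zero pair is
  obtained.\<close>

lemma self_action: "derived_action F A A (mult A) (mult A)"
  using galt unfolding g_alternative_def
  by unfold_locales (use mult_bilinear in blast)+

text \<open>The inductive definition has no rule for zero; the zero pair is the action of the zero
  of \<open>A\<close> on \<open>A\<close> itself. \<open>action_pair_in_action_pairs\<close>
  replaces \<open>A\<close> by an acting algebra of formal expressions.\<close>

lemma pair_zero_in_usga: "pair_zero A \<in> usga_carrier F A"
proof -
  have "action_pair A (mult A) (mult A) \<zero>\<^bsub>A\<^esub> \<in> action_pairs F A"
    using nonassoc_algebra_axioms galt self_action
    by (rule action_pair_in_action_pairs) simp
  moreover have "action_pair A (mult A) (mult A) \<zero>\<^bsub>A\<^esub> = pair_zero A"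
    by (auto simp: action_pair_def pair_zero_def mult_zero_left mult_zero_right intro!: restrict_ext)
  ultimately show ?thesis
    by (metis usga_carrier.base)
qed

text \<open>Scalar multiplication is not among the generating operations, so closure needs an
  induction. On a generator the scalar is absorbed into the acting element b; it distributes over
  sums and negatives, and in a product it is given to the first factor.\<close>

lemma smult_in_usga:
  assumes c: "c \<in> carrier F"
  shows "p \<in> usga_carrier F A \<Longrightarrow> pair_smult A c p \<in> usga_carrier F A"
proof (induction rule: usga_carrier.induct)
  case (base p)
  then obtain B :: "('f, 'f alg_expr) module" and l r b
    where B: "nonassoc_algebra F B" "g_alternative B" "derived_action F B A l r" "b \<in> carrier B"
      and p: "p = action_pair A l r b"
    unfolding action_pairs_def by blast
  interpret B: nonassoc_algebra F B by (rule B(1))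
  interpret derived_action F B A l r by (rule B(3))
  have "pair_smult A c p = action_pair A l r (c \<odot>\<^bsub>B\<^esub> b)"
    using c B(4) bilinear_mapD(4)[OF l_bilinear] bilinear_mapD(5)[OF r_bilinear]
    by (auto simp: p action_pair_def pair_smult_def intro!: restrict_ext)
  moreover have "c \<odot>\<^bsub>B\<^esub> b \<in> carrier B"
    using c B(4) by simp
  ultimately show ?case
    using B action_pair_in_action_pairs usga_carrier.base by metis
next
  case (add p q)
  obtain f g where "f \<in> centroid" "g \<in> centroid" "p = (f, f)" "q = (g, g)"
    using add usga_centroid by metis
  then have "pair_smult A c (pair_add A p q) = pair_add A (pair_smult A c p) (pair_smult A c q)"
    using c by (auto simp: pair_smult_def pair_add_def smult_r_distr centroidD(1) intro!: restrict_ext)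
  then show ?case
    using add.IH usga_carrier.add by metis
next
  case (neg p)
  obtain f where "f \<in> centroid" "p = (f, f)"
    using neg usga_centroid by metis
  then have "pair_smult A c (pair_neg A p) = pair_neg A (pair_smult A c p)"
    using c by (auto simp: pair_smult_def pair_neg_def smult_r_minus centroidD(1) intro!: restrict_ext)
  then show ?case
    using neg.IH usga_carrier.neg by metis
next
  case (mult p q)
  obtain f g where fg: "f \<in> centroid" "g \<in> centroid" "p = (f, f)" "q = (g, g)"
    using mult usga_centroid by metis
  have "pair_smult A c (pair_mult A p q) = pair_mult A (pair_smult A c p) q"
    unfolding fg(3,4) pair_smult_def fst_conv snd_conv pair_mult_centroid[OF centroid_smult[OF c fg(1)] fg(2)]
      pair_mult_centroid[OF fg(1,2)]
    by (simp add: centroidD(1)[OF fg(2)] cong: restrict_cong)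
  then show ?case
    using mult usga_carrier.mult by metis
qed

section \<open>The algebra structure of the actor\<close>

lemma usga_simps:
  "carrier (usga F A) = usga_carrier F A" "mult (usga F A) = pair_mult A"
  "zero (usga F A) = pair_zero A" "add (usga F A) = pair_add A" "smult (usga F A) = pair_smult A"
  by (simp_all add: usga_def)

lemma usga_cases:
  assumes "p \<in> usga_carrier F A"
  obtains f where "f \<in> centroid" "p = (f, f)"
  using usga_centroid[OF assms] by blast

lemma abelian_group_usga: "abelian_group (usga F A)"
proof (rule abelian_groupI, unfold usga_simps)
  fix p q assume "p \<in> usga_carrier F A" "q \<in> usga_carrier F A"
  then show "pair_add A p q \<in> usga_carrier F A"
    by (rule usga_carrier.add)
next
  show "pair_zero A \<in> usga_carrier F A"
    by (rule pair_zero_in_usga)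
next
  fix p q s
  assume "p \<in> usga_carrier F A" "q \<in> usga_carrier F A" "s \<in> usga_carrier F A"
  then show "pair_add A (pair_add A p q) s = pair_add A p (pair_add A q s)"
    by (auto elim!: usga_cases simp: pair_add_def centroidD(1) M.a_assoc intro!: restrict_ext)
next
  fix p q assume "p \<in> usga_carrier F A" "q \<in> usga_carrier F A"
  then show "pair_add A p q = pair_add A q p"
    by (auto elim!: usga_cases simp: pair_add_def centroidD(1) M.a_comm intro!: restrict_ext)
next
  fix p assume p: "p \<in> usga_carrier F A"
  then obtain f where f: "f \<in> centroid" "p = (f, f)"
    by (rule usga_cases)
  \<comment> \<open>Adding the zero pair yields a restricted map, so the neutral law is first proved
    between restrictions; \<open>centroidD(6)\<close> then identifies the restriction of f with
    f.\<close>
  have "restrict (\<lambda>x. \<zero>\<^bsub>A\<^esub> \<oplus>\<^bsub>A\<^esub> f x) (carrier A) = restrict f (carrier A)"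
    using f by (auto simp: centroidD(1) intro!: restrict_ext)
  then show "pair_add A (pair_zero A) p = p"
    using f by (simp add: pair_add_def pair_zero_def centroidD(6) cong: restrict_cong)
  have "pair_add A (pair_neg A p) p = pair_zero A"
    using f by (auto simp: pair_add_def pair_neg_def pair_zero_def centroidD(1) M.l_neg
        intro!: restrict_ext)
  then show "\<exists>q \<in> usga_carrier F A. pair_add A q p = pair_zero A"
    using p usga_carrier.neg by blast
qed

lemma module_usga: "module F (usga F A)"
proof (rule moduleI, unfold usga_simps)
  show "cring F"
    by (rule cring_axioms)
  show "abelian_group (usga F A)"
    by (rule abelian_group_usga)
next
  fix c p assume "c \<in> carrier F" "p \<in> usga_carrier F A"
  then show "pair_smult A c p \<in> usga_carrier F A"
    by (rule smult_in_usga)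
next
  fix c d p assume "c \<in> carrier F" "d \<in> carrier F" "p \<in> usga_carrier F A"
  then show "pair_smult A (c \<oplus>\<^bsub>F\<^esub> d) p = pair_add A (pair_smult A c p) (pair_smult A d p)"
    by (auto elim!: usga_cases simp: pair_add_def pair_smult_def centroidD(1) smult_l_distr
        intro!: restrict_ext)
next
  fix c p q assume "c \<in> carrier F" "p \<in> usga_carrier F A" "q \<in> usga_carrier F A"
  then show "pair_smult A c (pair_add A p q) = pair_add A (pair_smult A c p) (pair_smult A c q)"
    by (auto elim!: usga_cases simp: pair_add_def pair_smult_def centroidD(1) smult_r_distr
        intro!: restrict_ext)
next
  fix c d p assume "c \<in> carrier F" "d \<in> carrier F" "p \<in> usga_carrier F A"
  then show "pair_smult A (c \<otimes>\<^bsub>F\<^esub> d) p = pair_smult A c (pair_smult A d p)"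
    by (auto elim!: usga_cases simp: pair_smult_def centroidD(1) smult_assoc1 intro!: restrict_ext)
next
  fix p assume "p \<in> usga_carrier F A"
  then obtain f where f: "f \<in> centroid" "p = (f, f)"
    by (rule usga_cases)
  have "restrict (\<lambda>x. \<one>\<^bsub>F\<^esub> \<odot>\<^bsub>A\<^esub> f x) (carrier A) = restrict f (carrier A)"
    using f by (auto simp: centroidD(1) intro!: restrict_ext)
  then show "pair_smult A \<one>\<^bsub>F\<^esub> p = p"
    using f by (simp add: pair_smult_def centroidD(6))
qed

text \<open>Products are compositions. Linearity in the left factor is therefore just the pointwise
  definition of the operations, whereas in the right factor it is linearity of the outer
  map.\<close>

lemma bilinear_usga: "bilinear_map F (usga F A) (usga F A) (usga F A) (mult (usga F A))"
  unfolding bilinear_map_def usga_simps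
proof (intro conjI ballI)
  fix p q assume "p \<in> usga_carrier F A" "q \<in> usga_carrier F A"
  then show "pair_mult A p q \<in> usga_carrier F A"
    by (rule usga_carrier.mult)
next
  fix p q s
  assume "p \<in> usga_carrier F A" "q \<in> usga_carrier F A" "s \<in> usga_carrier F A"
  then obtain f g h where *: "f \<in> centroid" "g \<in> centroid" "h \<in> centroid"
    "p = (f, f)" "q = (g, g)" "s = (h, h)"
    by (metis usga_centroid)
  show "pair_mult A (pair_add A p q) s = pair_add A (pair_mult A p s) (pair_mult A q s)"
    unfolding *(4-6) pair_add_def fst_conv snd_conv pair_mult_centroid[OF centroid_add[OF *(1,2)] *(3)]
      pair_mult_centroid[OF *(1,3)] pair_mult_centroid[OF *(2,3)]
    by (simp add: centroidD(1)[OF *(3)] cong: restrict_cong)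
  show "pair_mult A p (pair_add A q s) = pair_add A (pair_mult A p q) (pair_mult A p s)"
    unfolding *(4-6) pair_add_def fst_conv snd_conv pair_mult_centroid[OF *(1) centroid_add[OF *(2,3)]]
      pair_mult_centroid[OF *(1,2)] pair_mult_centroid[OF *(1,3)]
    by (simp add: centroidD(2)[OF *(1)] centroidD(1)[OF *(2)] centroidD(1)[OF *(3)] cong: restrict_cong)
next
  fix c p q
  assume c: "c \<in> carrier F" and pq: "p \<in> usga_carrier F A" "q \<in> usga_carrier F A"
  then obtain f g where *: "f \<in> centroid" "g \<in> centroid" "p = (f, f)" "q = (g, g)"
    by (metis usga_centroid)
  show "pair_mult A (pair_smult A c p) q = pair_smult A c (pair_mult A p q)"
    unfolding *(3,4) pair_smult_def fst_conv snd_conv pair_mult_centroid[OF centroid_smult[OF c *(1)] *(2)]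
      pair_mult_centroid[OF *(1,2)]
    by (simp add: centroidD(1)[OF *(2)] cong: restrict_cong)
  show "pair_mult A p (pair_smult A c q) = pair_smult A c (pair_mult A p q)"
    unfolding *(3,4) pair_smult_def fst_conv snd_conv pair_mult_centroid[OF *(1) centroid_smult[OF c *(2)]]
      pair_mult_centroid[OF *(1,2)]
    by (simp add: c centroidD(3)[OF *(1)] centroidD(1)[OF *(2)] cong: restrict_cong)
qed

lemma nonassoc_algebra_usga: "nonassoc_algebra F (usga F A)"
  using module_usga bilinear_usga field_axioms
  by (simp add: nonassoc_algebra_def nonassoc_algebra_axioms_def)

section \<open>Associativity and alternativity of the actor\<close>

text \<open>Composition of maps is associative. \<open>centroid_comp\<close> keeps the inner
  products in the centroid, so that \<open>pair_mult_centroid\<close> applies a second time and both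
  sides become the restriction of f o g o h.\<close>

lemma associative_usga: "associative (usga F A)"
  unfolding associative_def usga_simps
proof (intro ballI)
  fix p q s
  assume "p \<in> usga_carrier F A" "q \<in> usga_carrier F A" "s \<in> usga_carrier F A"
  then obtain f g h where *: "f \<in> centroid" "g \<in> centroid" "h \<in> centroid"
    "p = (f, f)" "q = (g, g)" "s = (h, h)"
    by (metis usga_centroid)
  show "pair_mult A (pair_mult A p q) s = pair_mult A p (pair_mult A q s)"
    unfolding *(4-6) pair_mult_centroid[OF *(1,2)] pair_mult_centroid[OF *(2,3)]
      pair_mult_centroid[OF centroid_comp[OF *(1,2)] *(3)]
      pair_mult_centroid[OF *(1) centroid_comp[OF *(2,3)]]
    by (simp add: centroidD(1)[OF *(3)] cong: restrict_cong)
qed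

end

lemma associative_imp_alternative: "associative A \<Longrightarrow> alternative A"
  unfolding associative_def alternative_def by simp

theorem corollary7p2:
  fixes F :: "('f, 'm) ring_scheme"
    and A :: "('f, 'a, 'n) module_scheme"
  assumes "nonassoc_algebra F A"
    and "g_alternative A"
    and "anticommutative A"
    and "Ann A = {\<zero>\<^bsub>A\<^esub>}"
  shows "nonassoc_algebra F (usga F A) \<and> associative (usga F A) \<and> alternative (usga F A)"
proof -
  interpret faithful_anticomm_galt F A
    using assms by (simp add: faithful_anticomm_galt_def faithful_anticomm_galt_axioms_def)
  show ?thesis
    using nonassoc_algebra_usga associative_usga associative_imp_alternative by blast
qed

end
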